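(* Let $n$ be a positive integer and let $A=(a_{ij})$ be a real $n\times n$ matrix with $a_{ii}=0$ for all $i\in[n]$. If $A^*$ exists, then $C_A=C_{A^*}$.
   Context: Notation: $[n]=\{1,\dots,n\}$. Tropical operations on $\mathbb{R}$: $a\oplus b=\max\{a,b\}$ and $a\odot b=a+b$. All matrix sums, products and powers are tropical: $(A\oplus B)_{ij}=\max\{a_{ij},b_{ij}\}$ and $(AB)_{ij}=\max_k (a_{ik}+b_{kj})$. The matrix $A^*$ (the Kleene star of $A$): for a real square matrix $A$ of order $n$, $A^*=A\oplus A^2\oplus A^3\oplus\cdots$, if this limit exists in $\mathbb{R}^{n\times n}$ (i.e. all entries of the limit are finite real numbers). If $A$ has zero diagonal and $A^*$ exists, then $A^*$ also has zero diagonal. The set $C_A$: for a real $n\times n$ matrix $A=(a_{ij})$ with zero diagonal, $$C_A=\{x\in\mathbb{R}^{n-1}:\ a_{in}\le x_i\le -a_{ni},\ \ a_{ik}\le x_i-x_k\le -a_{ki},\ \text{ for all } i,k\in[n-1],\ i\ne k\}$$ (possibly empty). *)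

theory Defs
  imports Complex_Main "Jordan_Normal_Form.Matrix"
begin

text \<open>
  Matrices are \<open>real mat\<close>, so indices run over \<open>{..<n}\<close> instead of
  \<open>{1..n}\<close>; the distinguished last index is \<open>n - 1\<close>. The case \<open>n = 1\<close>, where
  \<open>C_A\<close> lives in the zero-dimensional space, is included.
\<close>

definition trop_add :: "real mat \<Rightarrow> real mat \<Rightarrow> real mat" where
  "trop_add A B = mat (dim_row A) (dim_col A) (\<lambda>(i, j). max (A $$ (i, j)) (B $$ (i, j)))"

text \<open>Only meaningful for a nonempty inner dimension, since \<open>Max {}\<close> is unspecified.\<close>

definition trop_mult :: "real mat \<Rightarrow> real mat \<Rightarrow> real mat" where
  "trop_mult A B = mat (dim_row A) (dim_col B)
     (\<lambda>(i, j). Max ((\<lambda>k. A $$ (i, k) + B $$ (k, j)) ` {..<dim_col A}))"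

text \<open>\<open>trop_power_Suc A m\<close> is the tropical power of exponent \<open>m + 1\<close>: exponents start at 1,
  because the tropical identity has entries \<open>-\<infinity>\<close> and is not a real matrix. Likewise
  \<open>trop_partial_star A m\<close> is the tropical sum of the powers with exponents \<open>1, \<dots>, m + 1\<close>.\<close>

primrec trop_power_Suc :: "real mat \<Rightarrow> nat \<Rightarrow> real mat" where
  "trop_power_Suc A 0 = A"
| "trop_power_Suc A (Suc m) = trop_mult (trop_power_Suc A m) A"

primrec trop_partial_star :: "real mat \<Rightarrow> nat \<Rightarrow> real mat" where
  "trop_partial_star A 0 = trop_power_Suc A 0"
| "trop_partial_star A (Suc m) = trop_add (trop_partial_star A m) (trop_power_Suc A (Suc m))"

text \<open>Convergence is entrywise in \<open>\<real>\<close>, so every entry of the limit is a finite real number.\<close>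

definition kleene_star_exists :: "real mat \<Rightarrow> bool" where
  "kleene_star_exists A \<longleftrightarrow>
     (\<forall>i<dim_row A. \<forall>j<dim_col A. convergent (\<lambda>m. trop_partial_star A m $$ (i, j)))"

definition kleene_star :: "real mat \<Rightarrow> real mat" where
  "kleene_star A = mat (dim_row A) (dim_col A) (\<lambda>(i, j). lim (\<lambda>m. trop_partial_star A m $$ (i, j)))"

definition C_set :: "real mat \<Rightarrow> real vec set" where
  "C_set A = (let n = dim_row A in
     {x \<in> carrier_vec (n - 1).
        (\<forall>i<n - 1. A $$ (i, n - 1) \<le> x $ i \<and> x $ i \<le> - A $$ (n - 1, i)) \<and>
        (\<forall>i<n - 1. \<forall>k<n - 1. i \<noteq> k \<longrightarrow>
           A $$ (i, k) \<le> x $ i - x $ k \<and> x $ i - x $ k \<le> - A $$ (k, i))})"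

end

theory Submission imports Defs begin

text \<open>
  Give a point of \<open>C_A\<close> the additional last coordinate 0. The two families of inequalities in the
  definition then become the single family \<open>a\<^sub>i\<^sub>k \<le> y\<^sub>i - y\<^sub>k\<close>: the vector \<open>y\<close> is a potential for
  \<open>A\<close>. An entry of a tropical power of \<open>A\<close> is the maximal weight of a walk of fixed length from
  \<open>i\<close> to \<open>k\<close>, and along a walk the differences \<open>y\<^sub>i - y\<^sub>k\<close> telescope. Hence a potential for
  \<open>A\<close> bounds every tropical power, every partial sum of the Kleene star, and so the limit
  (\<open>potential_kleene_star\<close>). Conversely the first summand of the Kleene star is \<open>A\<close> itself, so
  \<open>A \<le> A\<^sup>*\<close> entrywise and a potential for \<open>A\<^sup>*\<close> is one for \<open>A\<close> (\<open>le_kleene_star\<close>).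
\<close>

definition potential :: "real mat \<Rightarrow> (nat \<Rightarrow> real) \<Rightarrow> bool" where
  "potential A y \<longleftrightarrow> (\<forall>i<dim_row A. \<forall>k<dim_col A. A $$ (i, k) \<le> y i - y k)"

definition zero_extension :: "real vec \<Rightarrow> nat \<Rightarrow> real" where
  "zero_extension x i = (if i < dim_vec x then x $ i else 0)"

text \<open>The upper bounds in the definition of \<open>C_B\<close> are the lower bounds for the transposed pair of
  indices, and the bounds on single coordinates are those for pairs involving the last index.\<close>

lemma C_set_iff_zero_extension:
  assumes "n > 0" and B: "B \<in> carrier_mat n n"
  shows "x \<in> C_set B \<longleftrightarrow> x \<in> carrier_vec (n - 1) \<and>
    (\<forall>i<n. \<forall>k<n. i \<noteq> k \<longrightarrow> B $$ (i, k) \<le> zero_extension x i - zero_extension x k)"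
    (is "_ \<longleftrightarrow> _ \<and> ?P")
proof (cases "x \<in> carrier_vec (n - 1)")
  case True
  obtain m where n: "n = Suc m" using \<open>n > 0\<close> gr0_implies_Suc by blast
  have dim: "dim_vec x = m" "dim_row B = Suc m" using True B n by auto
  have "?P \<longleftrightarrow> (\<forall>i<m. B $$ (i, m) \<le> x $ i \<and> x $ i \<le> - B $$ (m, i)) \<and>
      (\<forall>i<m. \<forall>k<m. i \<noteq> k \<longrightarrow> B $$ (i, k) \<le> x $ i - x $ k \<and> x $ i - x $ k \<le> - B $$ (k, i))"
    (is "_ \<longleftrightarrow> ?Q")
  proof
    assume P: ?P
    have last: "B $$ (i, m) \<le> x $ i \<and> x $ i \<le> - B $$ (m, i)" if "i < m" for i
      using P[rule_format, of i m] P[rule_format, of m i] that n dim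
      by (simp add: zero_extension_def)
    have "B $$ (i, k) \<le> x $ i - x $ k \<and> x $ i - x $ k \<le> - B $$ (k, i)"
      if "i < m" "k < m" "i \<noteq> k" for i k
      using P[rule_format, of i k] P[rule_format, of k i] that n dim
      by (simp add: zero_extension_def)
    with last show ?Q by blast
  next
    assume Q: ?Q
    show ?P
    proof (intro allI impI)
      fix i k assume "i < n" "k < n" "i \<noteq> k"
      then consider "i < m" "k < m" | "i < m" "k = m" | "i = m" "k < m"
        using n by linarith
      then show "B $$ (i, k) \<le> zero_extension x i - zero_extension x k"
      proof cases
        case 1
        then show ?thesis using Q \<open>i \<noteq> k\<close> dim by (simp add: zero_extension_def)
      next
        case 2
        then show ?thesis using Q dim by (simp add: zero_extension_def)
      next
        case 3
        then have "x $ k \<le> - B $$ (m, k)" using Q by blast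
        then show ?thesis using 3 dim by (simp add: zero_extension_def)
      qed
    qed
  qed
  then show ?thesis using True n dim by (simp add: C_set_def Let_def)
next
  case False
  then show ?thesis using B by (auto simp: C_set_def Let_def)
qed

lemma trop_power_Suc_carrier [simp]:
  "A \<in> carrier_mat n n \<Longrightarrow> trop_power_Suc A m \<in> carrier_mat n n"
  by (induction m) (auto simp: trop_mult_def)

lemma trop_partial_star_carrier [simp]:
  "A \<in> carrier_mat n n \<Longrightarrow> trop_partial_star A m \<in> carrier_mat n n"
  by (induction m) (auto simp: trop_add_def)

lemma kleene_star_carrier [simp]:
  "A \<in> carrier_mat n n \<Longrightarrow> kleene_star A \<in> carrier_mat n n"
  by (simp add: kleene_star_def)

text \<open>Telescoping over the intermediate index: \<open>(y\<^sub>i - y\<^sub>l) + (y\<^sub>l - y\<^sub>k) = y\<^sub>i - y\<^sub>k\<close>. There has to be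
  an intermediate index, because the maximum over the empty set is unspecified.\<close>

lemma potential_trop_mult:
  assumes "potential A y" "potential B y" "dim_col A = dim_row B" "dim_col A > 0"
  shows "potential (trop_mult A B) y"
proof -
  have "A $$ (i, l) + B $$ (l, k) \<le> y i - y k"
    if "i < dim_row A" "l < dim_col A" "k < dim_col B" for i l k
  proof -
    have "A $$ (i, l) \<le> y i - y l" "B $$ (l, k) \<le> y l - y k"
      using assms that by (auto simp: potential_def)
    then show ?thesis by linarith
  qed
  moreover have "{..<dim_col A} \<noteq> {}" using assms(4) by auto
  ultimately show ?thesis by (simp add: potential_def trop_mult_def)
qed

lemma potential_trop_power_Suc:
  assumes "A \<in> carrier_mat n n" "n > 0" "potential A y"
  shows "potential (trop_power_Suc A m) y"
proof (induction m)
  case (Suc m)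
  then show ?case
    using assms carrier_matD[OF trop_power_Suc_carrier[OF assms(1), of m]]
    by (simp add: potential_trop_mult)
qed (use assms in simp)

lemma potential_trop_partial_star:
  assumes A: "A \<in> carrier_mat n n" and "n > 0" "potential A y"
  shows "potential (trop_partial_star A m) y"
proof (induction m)
  case (Suc m)
  have "potential (trop_power_Suc A (Suc m)) y"
    using assms by (rule potential_trop_power_Suc)
  with Suc show ?case
    using carrier_matD[OF trop_partial_star_carrier[OF A, of m]]
      carrier_matD[OF trop_power_Suc_carrier[OF A, of "Suc m"]]
    by (simp add: potential_def trop_add_def)
qed (use assms in simp)

lemma le_trop_partial_star:
  assumes A: "A \<in> carrier_mat n n" and "i < n" "k < n"
  shows "A $$ (i, k) \<le> trop_partial_star A m $$ (i, k)"
proof (induction m)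
  case (Suc m)
  then show ?case
    using assms carrier_matD[OF trop_partial_star_carrier[OF A, of m]]
    by (simp add: trop_add_def le_max_iff_disj)
qed simp

lemma trop_partial_star_tendsto_kleene_star:
  assumes "A \<in> carrier_mat n n" "kleene_star_exists A" "i < n" "k < n"
  shows "(\<lambda>m. trop_partial_star A m $$ (i, k)) \<longlonglongrightarrow> kleene_star A $$ (i, k)"
  using assms by (simp add: kleene_star_exists_def kleene_star_def convergent_LIMSEQ_iff)

lemma le_kleene_star:
  assumes "A \<in> carrier_mat n n" "kleene_star_exists A" "i < n" "k < n"
  shows "A $$ (i, k) \<le> kleene_star A $$ (i, k)"
  using trop_partial_star_tendsto_kleene_star[OF assms] le_trop_partial_star[OF assms(1,3,4)]
  by (intro LIMSEQ_le_const) auto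

lemma potential_kleene_star:
  assumes A: "A \<in> carrier_mat n n" and "n > 0" "kleene_star_exists A" "potential A y"
  shows "potential (kleene_star A) y"
proof -
  have "kleene_star A $$ (i, k) \<le> y i - y k" if "i < n" "k < n" for i k
  proof -
    have "trop_partial_star A m $$ (i, k) \<le> y i - y k" for m
      using potential_trop_partial_star[OF A assms(2,4), of m]
        trop_partial_star_carrier[OF A, of m] that
      by (auto simp: potential_def)
    then show ?thesis
      using trop_partial_star_tendsto_kleene_star[OF A assms(3) that]
      by (intro LIMSEQ_le_const2) auto
  qed
  then show ?thesis using kleene_star_carrier[OF A] by (auto simp: potential_def)
qed

theorem lemma6:
  fixes n :: nat and A :: "real mat"
  assumes "n > 0"
    and "A \<in> carrier_mat n n"
    and "\<And>i. i < n \<Longrightarrow> A $$ (i, i) = 0"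
    and "kleene_star_exists A"
  shows "C_set A = C_set (kleene_star A)"
proof -
  note A_iff = C_set_iff_zero_extension[OF assms(1,2)]
  note star_iff = C_set_iff_zero_extension[OF assms(1) kleene_star_carrier[OF assms(2)]]
  have "x \<in> C_set (kleene_star A)" if x: "x \<in> C_set A" for x
  proof -
    \<comment> \<open>The zero diagonal supplies the inequalities for equal indices, which \<open>C_A\<close> leaves out but
      which are needed because walks may stay at an index.\<close>
    have "A $$ (i, k) \<le> zero_extension x i - zero_extension x k" if "i < n" "k < n" for i k
      using x that assms(3) by (cases "i = k") (auto simp: A_iff)
    then have "potential A (zero_extension x)"
      using assms(2) by (auto simp: potential_def)
    then have "potential (kleene_star A) (zero_extension x)"
      using assms by (intro potential_kleene_star)
    then show ?thesis
      using x kleene_star_carrier[OF assms(2)] by (auto simp: A_iff star_iff potential_def)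
  qed
  moreover have "x \<in> C_set A" if "x \<in> C_set (kleene_star A)" for x
    using that le_kleene_star[OF assms(2,4)] unfolding A_iff star_iff by (meson order_trans)
  ultimately show ?thesis by blast
qed

end
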